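(* Let $\lambda\in\mathbb{C}$ with $|\lambda|=1$, let $\phi\in H^\infty(\mathbb{D})$, and let $T=R_\lambda\phi(B)$ on $H^2(\mathbb{D})$. If $\phi(\mathbb{D})\cap\partial\mathbb{D}=\emptyset$, then $T$ is not hypercyclic.
   Context: $\mathbb{D}$ is the open unit disk, $H^2(\mathbb{D})$ the Hardy space. $B$ is the backward shift: $B1=0$, $Bz^n=z^{n-1}$ for $n\ge1$. $R_\lambda f(z)=f(\lambda z)$. For $\phi\in H^\infty(\mathbb{D})$, $\phi(B)$ denotes $M_{\overline{\phi}}^\star$, the adjoint of multiplication by $\overline{\phi}(z):=\overline{\phi(\overline{z})}$ on $H^2(\mathbb{D})$ (i.e. $\sum_k c_kB^k$ if $\phi=\sum_k c_kz^k$). A bounded operator $T$ is hypercyclic if there is a vector $f$ whose orbit $\{T^nf: n\in\mathbb{N}\}$ is dense. *)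

theory Defs
  imports "HOL-Complex_Analysis.Complex_Analysis"
begin

abbreviation unit_disc :: "complex set"
  where "unit_disc \<equiv> ball 0 1"

definition taylor_coeff :: "(complex \<Rightarrow> complex) \<Rightarrow> nat \<Rightarrow> complex"
  where "taylor_coeff f n = (deriv ^^ n) f 0 / fact n"

text \<open>
  An element of the Hardy space is a function on the disc; it is represented by the total function
  that vanishes off the disc, so that equality in the space is equality of functions.
\<close>

definition hardy2 :: "(complex \<Rightarrow> complex) set"
  where "hardy2 = {f. f holomorphic_on unit_disc \<and> (\<forall>z. z \<notin> unit_disc \<longrightarrow> f z = 0) \<and>
                      summable (\<lambda>n. (cmod (taylor_coeff f n))\<^sup>2)}"

definition hardy2_inner :: "(complex \<Rightarrow> complex) \<Rightarrow> (complex \<Rightarrow> complex) \<Rightarrow> complex"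
  where "hardy2_inner f g = (\<Sum>n. taylor_coeff f n * cnj (taylor_coeff g n))"

definition hardy2_norm :: "(complex \<Rightarrow> complex) \<Rightarrow> real"
  where "hardy2_norm f = sqrt (\<Sum>n. (cmod (taylor_coeff f n))\<^sup>2)"

text \<open>Values of a symbol off the disc are irrelevant: it only ever multiplies elements of
  \<^const>\<open>hardy2\<close>, which vanish there.\<close>

definition hardy_infinity :: "(complex \<Rightarrow> complex) set"
  where "hardy_infinity = {\<phi>. \<phi> holomorphic_on unit_disc \<and> bounded (\<phi> ` unit_disc)}"

definition mult_op :: "(complex \<Rightarrow> complex) \<Rightarrow> (complex \<Rightarrow> complex) \<Rightarrow> (complex \<Rightarrow> complex)"
  where "mult_op \<psi> f = (\<lambda>z. \<psi> z * f z)"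

text \<open>The Hilbert space adjoint; for an operator that is bounded and linear on \<^const>\<open>hardy2\<close>,
  the vector described exists and is unique by the Riesz representation theorem.\<close>

definition hardy2_adjoint ::
  "((complex \<Rightarrow> complex) \<Rightarrow> (complex \<Rightarrow> complex)) \<Rightarrow> (complex \<Rightarrow> complex) \<Rightarrow> (complex \<Rightarrow> complex)"
  where "hardy2_adjoint A g =
    (THE h. h \<in> hardy2 \<and> (\<forall>f\<in>hardy2. hardy2_inner (A f) g = hardy2_inner f h))"

definition conj_symbol :: "(complex \<Rightarrow> complex) \<Rightarrow> (complex \<Rightarrow> complex)"
  where "conj_symbol \<phi> = (\<lambda>z. cnj (\<phi> (cnj z)))"

text \<open>The operator \<open>\<phi>(B)\<close>, where \<open>B\<close> is the backward shift.\<close>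

definition backward_shift_calc ::
  "(complex \<Rightarrow> complex) \<Rightarrow> (complex \<Rightarrow> complex) \<Rightarrow> (complex \<Rightarrow> complex)"
  where "backward_shift_calc \<phi> = hardy2_adjoint (mult_op (conj_symbol \<phi>))"

definition rotation_op :: "complex \<Rightarrow> (complex \<Rightarrow> complex) \<Rightarrow> (complex \<Rightarrow> complex)"
  where "rotation_op c f = (\<lambda>z. f (c * z))"

definition orbit ::
  "((complex \<Rightarrow> complex) \<Rightarrow> (complex \<Rightarrow> complex)) \<Rightarrow> (complex \<Rightarrow> complex) \<Rightarrow> (complex \<Rightarrow> complex) set"
  where "orbit T f = {(T ^^ n) f |n. True}"

text \<open>Density is with respect to the norm of \<^const>\<open>hardy2\<close>.\<close>

definition hypercyclic :: "((complex \<Rightarrow> complex) \<Rightarrow> (complex \<Rightarrow> complex)) \<Rightarrow> bool"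
  where "hypercyclic T \<longleftrightarrow>
    (\<exists>f\<in>hardy2. \<forall>g\<in>hardy2. \<forall>\<epsilon>>0. \<exists>h\<in>orbit T f. hardy2_norm (\<lambda>z. h z - g z) < \<epsilon>)"

end

theory Submission
  imports Defs
begin

text \<open>
  The image of the disc under \<open>\<phi>\<close> is connected and misses the unit circle, so \<open>|\<phi>| \<le> 1\<close> or \<open>|\<phi>| \<ge> 1\<close>
  throughout the disc. Let \<open>\<psi>\<close> be the conjugate symbol and \<open>h = \<phi>(B) g\<close>. In the first case
  \<open>\<parallel>h\<parallel>\<^sup>2 = \<langle>\<psi> h, g\<rangle> \<le> \<parallel>h\<parallel> \<parallel>g\<parallel>\<close> makes \<open>\<phi>(B)\<close> a contraction; in the second
  \<open>\<parallel>g\<parallel>\<^sup>2 = \<langle>\<psi>\<^sup>-\<^sup>1 g, h\<rangle> \<le> \<parallel>g\<parallel> \<parallel>h\<parallel>\<close> makes it an expansion. Rotation is isometric, so orbits of \<open>T\<close> are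
  norm bounded in the first case, and in the second they stay away from the origin unless they start
  there.
\<close>

subsection \<open>Coefficients of functions in the Hardy space\<close>

text \<open>The finite Cauchy-Schwarz inequality \<open>L2_set_mult_ineq\<close> bounds every
  partial sum of the moduli by one constant, which yields absolute convergence and the inequality
  together.\<close>

lemma
  fixes a b :: "nat \<Rightarrow> complex"
  assumes "summable (\<lambda>n. (cmod (a n))\<^sup>2)" "summable (\<lambda>n. (cmod (b n))\<^sup>2)"
  shows summable_norm_mult_cnj: "summable (\<lambda>n. cmod (a n * cnj (b n)))"
    and Cauchy_Schwarz_suminf:
      "cmod (\<Sum>n. a n * cnj (b n)) \<le> sqrt (\<Sum>n. (cmod (a n))\<^sup>2) * sqrt (\<Sum>n. (cmod (b n))\<^sup>2)"
proof -
  let ?A = "\<Sum>n. (cmod (a n))\<^sup>2" and ?B = "\<Sum>n. (cmod (b n))\<^sup>2"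
  have bound: "(\<Sum>n<N. cmod (a n * cnj (b n))) \<le> sqrt ?A * sqrt ?B" for N
  proof -
    have "(\<Sum>n<N. cmod (a n * cnj (b n))) = (\<Sum>n<N. \<bar>cmod (a n)\<bar> * \<bar>cmod (b n)\<bar>)"
      by (simp add: norm_mult)
    also have "\<dots> \<le> L2_set (\<lambda>n. cmod (a n)) {..<N} * L2_set (\<lambda>n. cmod (b n)) {..<N}"
      by (rule L2_set_mult_ineq)
    also have "\<dots> \<le> sqrt ?A * sqrt ?B"
      unfolding L2_set_def using assms
      by (intro mult_mono real_sqrt_le_mono sum_le_suminf) (auto simp: suminf_nonneg sum_nonneg)
    finally show ?thesis .
  qed
  show *: "summable (\<lambda>n. cmod (a n * cnj (b n)))"
    by (rule summableI_nonneg_bounded[OF _ bound]) simp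
  show "cmod (\<Sum>n. a n * cnj (b n)) \<le> sqrt ?A * sqrt ?B"
    using summable_norm[OF *] suminf_le_const[OF * bound] by linarith
qed

lemma summable_power2_norm_add:
  fixes a b :: "nat \<Rightarrow> complex"
  assumes "summable (\<lambda>n. (cmod (a n))\<^sup>2)" "summable (\<lambda>n. (cmod (b n))\<^sup>2)"
  shows "summable (\<lambda>n. (cmod (a n + b n))\<^sup>2)"
proof (rule summable_comparison_test'[where N = 0])
  show "summable (\<lambda>n. 2 * (cmod (a n))\<^sup>2 + 2 * (cmod (b n))\<^sup>2)"
    by (intro summable_add summable_mult assms)
  fix n
  have "(cmod (a n + b n))\<^sup>2 \<le> (cmod (a n) + cmod (b n))\<^sup>2"
    by (intro power_mono norm_triangle_ineq) simp
  also have "\<dots> \<le> 2 * (cmod (a n))\<^sup>2 + 2 * (cmod (b n))\<^sup>2"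
    using sum_squares_bound[of "cmod (a n)" "cmod (b n)"] by (simp add: power2_sum)
  finally show "norm ((cmod (a n + b n))\<^sup>2) \<le> 2 * (cmod (a n))\<^sup>2 + 2 * (cmod (b n))\<^sup>2"
    by simp
qed

section \<open>Taylor coefficients and power series on the disc\<close>

lemma taylor_coeff_sums:
  assumes "f holomorphic_on unit_disc" "z \<in> unit_disc"
  shows "(\<lambda>n. taylor_coeff f n * z ^ n) sums f z"
  using holomorphic_power_series[OF assms] by (simp add: taylor_coeff_def)

text \<open>Uniqueness of power series: convergence at the single point 1/2 already forces a
  positive radius of convergence, and the resulting expansion at 0 determines the derivatives there.
  Coefficient formulas below thus reduce to termwise manipulation of series.\<close>

lemma taylor_coeff_eqI:
  assumes "\<And>z. z \<in> unit_disc \<Longrightarrow> (\<lambda>n. a n * z ^ n) sums f z"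
  shows "taylor_coeff f n = a n"
proof -
  have "summable (\<lambda>n. a n * (1 / 2) ^ n)"
    using assms[of "1 / 2"] by (auto simp: sums_iff)
  then have "fps_conv_radius (Abs_fps a) \<ge> norm (1 / 2 :: complex)"
    unfolding fps_conv_radius_def by (intro conv_radius_geI) simp
  then have "0 < fps_conv_radius (Abs_fps a)"
    by (rule order.strict_trans2[rotated]) simp
  moreover have "\<forall>\<^sub>F z in nhds 0. eval_fps (Abs_fps a) z = f z"
    using eventually_nhds_in_open[of unit_disc 0]
    by (rule eventually_mono) (use assms in \<open>auto simp: eval_fps_def sums_iff\<close>)
  ultimately have "f has_fps_expansion Abs_fps a"
    by (simp add: has_fps_expansion_def)
  then show ?thesis
    using fps_nth_fps_expansion[of f "Abs_fps a" n] by (simp add: taylor_coeff_def)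
qed

lemma taylor_coeff_add:
  assumes "f holomorphic_on unit_disc" "g holomorphic_on unit_disc"
  shows "taylor_coeff (\<lambda>z. f z + g z) n = taylor_coeff f n + taylor_coeff g n"
  by (rule taylor_coeff_eqI)
    (use assms in \<open>auto simp: distrib_right intro!: sums_add taylor_coeff_sums\<close>)

lemma taylor_coeff_cmult:
  assumes "f holomorphic_on unit_disc"
  shows "taylor_coeff (\<lambda>z. a * f z) n = a * taylor_coeff f n"
  by (rule taylor_coeff_eqI)
    (use assms in \<open>auto simp: mult.assoc intro!: sums_mult taylor_coeff_sums\<close>)

lemma taylor_coeff_diff:
  assumes "f holomorphic_on unit_disc" "g holomorphic_on unit_disc"
  shows "taylor_coeff (\<lambda>z. f z - g z) n = taylor_coeff f n - taylor_coeff g n"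
  by (rule taylor_coeff_eqI)
    (use assms in \<open>auto simp: left_diff_distrib intro!: sums_diff taylor_coeff_sums\<close>)

text \<open>Inside the disc the power series decides, outside it the convention that elements of
  \<open>hardy2\<close> vanish there. This gives the uniqueness behind the definite description in
  \<open>hardy2_adjoint\<close>.\<close>

lemma hardy2_eqI:
  assumes "f \<in> hardy2" "g \<in> hardy2" "\<And>n. taylor_coeff f n = taylor_coeff g n"
  shows "f = g"
proof
  fix z
  show "f z = g z"
  proof (cases "z \<in> unit_disc")
    case True
    then have "(\<lambda>n. taylor_coeff f n * z ^ n) sums f z" "(\<lambda>n. taylor_coeff g n * z ^ n) sums g z"
      using assms(1,2) by (auto simp: hardy2_def intro!: taylor_coeff_sums)
    then show ?thesis
      using assms(3) by (simp add: sums_iff)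
  qed (use assms in \<open>auto simp: hardy2_def\<close>)
qed

definition hardy2_of_coeffs :: "(nat \<Rightarrow> complex) \<Rightarrow> complex \<Rightarrow> complex"
  where "hardy2_of_coeffs a = (\<lambda>z. if z \<in> unit_disc then \<Sum>n. a n * z ^ n else 0)"

text \<open>Together with \<open>hardy2_eqI\<close> this identifies \<open>hardy2\<close> with the
  square-summable sequences. The series converges in the disc by Cauchy-Schwarz against a geometric
  sequence.\<close>

lemma
  assumes "summable (\<lambda>n. (cmod (a n))\<^sup>2)"
  shows hardy2_of_coeffs: "hardy2_of_coeffs a \<in> hardy2"
    and taylor_coeff_hardy2_of_coeffs: "taylor_coeff (hardy2_of_coeffs a) n = a n"
proof -
  have sums: "(\<lambda>n. a n * z ^ n) sums hardy2_of_coeffs a z" if z: "z \<in> unit_disc" for z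
  proof -
    \<comment> \<open>The conjugate appears because \<open>summable_norm_mult_cnj\<close> conjugates
      its second sequence, which turns \<open>cnj z ^ n\<close> back into
      \<open>z ^ n\<close>.\<close>
    have "summable (\<lambda>n. (cmod (cnj z ^ n))\<^sup>2)"
    proof -
      have "summable (\<lambda>n. ((cmod z)\<^sup>2) ^ n)"
        using z by (intro summable_geometric) (simp add: abs_square_less_1)
      moreover have "(cmod (cnj z ^ n))\<^sup>2 = ((cmod z)\<^sup>2) ^ n" for n
        by (simp add: norm_power power2_eq_square power_mult_distrib)
      ultimately show ?thesis
        by (simp only:)
    qed
    from summable_norm_mult_cnj[OF assms this] have "summable (\<lambda>n. a n * z ^ n)"
      using summable_norm_cancel[of "\<lambda>n. a n * z ^ n"] by simp
    then show ?thesis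
      using z by (simp add: hardy2_of_coeffs_def summable_sums)
  qed
  show c: "taylor_coeff (hardy2_of_coeffs a) n = a n" for n
    using sums by (rule taylor_coeff_eqI)
  have "hardy2_of_coeffs a holomorphic_on unit_disc"
    by (rule power_series_holomorphic[where a = a]) (use sums in simp)
  moreover have "hardy2_of_coeffs a z = 0" if "z \<notin> unit_disc" for z
    using that by (simp add: hardy2_of_coeffs_def)
  ultimately show "hardy2_of_coeffs a \<in> hardy2"
    using assms by (simp add: hardy2_def c)
qed

section \<open>Linear structure, norm and inner product\<close>

lemma hardy2D:
  assumes "f \<in> hardy2"
  shows "f holomorphic_on unit_disc" "summable (\<lambda>n. (cmod (taylor_coeff f n))\<^sup>2)"
    "z \<notin> unit_disc \<Longrightarrow> f z = 0"
  using assms by (auto simp: hardy2_def)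

lemma hardy2_add: "f \<in> hardy2 \<Longrightarrow> g \<in> hardy2 \<Longrightarrow> (\<lambda>z. f z + g z) \<in> hardy2"
  by (auto simp: hardy2_def taylor_coeff_add summable_power2_norm_add intro!: holomorphic_intros)

lemma hardy2_cmult: "f \<in> hardy2 \<Longrightarrow> (\<lambda>z. a * f z) \<in> hardy2"
  by (auto simp: hardy2_def taylor_coeff_cmult norm_mult power_mult_distrib
      intro!: holomorphic_intros summable_mult)

lemma hardy2_diff: "f \<in> hardy2 \<Longrightarrow> g \<in> hardy2 \<Longrightarrow> (\<lambda>z. f z - g z) \<in> hardy2"
  using hardy2_add[OF _ hardy2_cmult[of g "-1"], of f] by simp

lemma hardy2_norm_nonneg: "f \<in> hardy2 \<Longrightarrow> 0 \<le> hardy2_norm f"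
  by (simp add: hardy2_norm_def suminf_nonneg hardy2D)

lemma hardy2_norm_power2:
  assumes "f \<in> hardy2"
  shows "(hardy2_norm f)\<^sup>2 = (\<Sum>n. (cmod (taylor_coeff f n))\<^sup>2)"
  using hardy2D(2)[OF assms] by (simp add: hardy2_norm_def suminf_nonneg)

lemma norm_hardy2_inner_le:
  "f \<in> hardy2 \<Longrightarrow> g \<in> hardy2 \<Longrightarrow> cmod (hardy2_inner f g) \<le> hardy2_norm f * hardy2_norm g"
  unfolding hardy2_inner_def hardy2_norm_def by (intro Cauchy_Schwarz_suminf hardy2D)

lemma hardy2_inner_sums:
  assumes "f \<in> hardy2" "g \<in> hardy2"
  shows "(\<lambda>n. taylor_coeff f n * cnj (taylor_coeff g n)) sums hardy2_inner f g"
  unfolding hardy2_inner_def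
  by (intro summable_sums summable_norm_cancel[OF summable_norm_mult_cnj] hardy2D assms)

lemma hardy2_inner_self:
  assumes "f \<in> hardy2"
  shows "hardy2_inner f f = complex_of_real ((hardy2_norm f)\<^sup>2)"
  using sums_of_real[OF summable_sums[OF hardy2D(2)[OF assms]], where 'a = complex]
    hardy2_inner_sums[OF assms assms]
  by (simp add: hardy2_norm_power2[OF assms] complex_norm_square sums_iff del: of_real_power)

lemma norm_hardy2_inner_self: "f \<in> hardy2 \<Longrightarrow> cmod (hardy2_inner f f) = (hardy2_norm f)\<^sup>2"
  by (simp only: hardy2_inner_self norm_of_real) simp

lemma norm_taylor_coeff_le:
  assumes "f \<in> hardy2"
  shows "cmod (taylor_coeff f n) \<le> hardy2_norm f"
proof -
  have "(\<Sum>k\<in>{n}. (cmod (taylor_coeff f k))\<^sup>2) \<le> (\<Sum>k. (cmod (taylor_coeff f k))\<^sup>2)"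
    using hardy2D(2)[OF assms] by (intro sum_le_suminf) auto
  then show ?thesis
    unfolding hardy2_norm_def by (simp add: real_le_rsqrt)
qed

subsection \<open>Multiplication by bounded holomorphic functions\<close>

lemma has_integral_cis_period:
  fixes k :: int
  shows "((\<lambda>t::real. cis (k * t)) has_integral (if k = 0 then 2 * pi else 0)) {0..2 * pi}"
proof (cases "k = 0")
  case True
  then show ?thesis
    using has_integral_const_real[of "1::complex" 0 "2 * pi"] by (simp add: scaleR_conv_of_real)
next
  case False
  \<comment> \<open>For nonzero \<open>k\<close> the antiderivative is itself periodic, so its
    boundary values cancel.\<close>
  have "((\<lambda>t::real. cis (k * t)) has_integral (cis (k * (2 * pi)) / (\<i> * k) - cis (k * (0::real)) / (\<i> * k))) {0..2 * pi}"
  proof (rule fundamental_theorem_of_calculus)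
    fix t :: real
    have "((\<lambda>w. exp (\<i> * k * w) / (\<i> * k)) has_field_derivative exp (\<i> * k * complex_of_real t))
        (at (complex_of_real t))"
      using False by (auto intro!: derivative_eq_intros)
    then have "((\<lambda>t. exp (\<i> * k * complex_of_real t) / (\<i> * k)) has_vector_derivative
        exp (\<i> * k * complex_of_real t)) (at t within {0..2 * pi})"
      by (rule has_vector_derivative_real_field)
    then show "((\<lambda>t. cis (k * t) / (\<i> * k)) has_vector_derivative cis (k * t)) (at t within {0..2 * pi})"
      by (simp add: cis_conv_exp mult.assoc)
  qed simp
  moreover have "cis (k * (2 * pi)) = 1"
    using cis_multiple_2pi[of "of_int k"] by (simp add: mult_ac)
  ultimately show ?thesis
    using False by simp
qed

text \<open>Expanding the product gives a double sum of characters; by orthogonality only the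
  diagonal survives integration.\<close>

lemma has_integral_trigonometric_polynomial:
  fixes a :: "nat \<Rightarrow> complex"
  shows "((\<lambda>t::real. (\<Sum>n<N. a n * cis (n * t)) * cnj (\<Sum>n<N. a n * cis (n * t)))
    has_integral (2 * pi * (\<Sum>n<N. (cmod (a n))\<^sup>2))) {0..2 * pi}"
proof -
  have cis: "cis (of_int (int n - int m) * t) = cis (n * t) * cnj (cis (m * t))" for n m :: nat and t :: real
    by (simp add: cis_cnj cis_mult left_diff_distrib)
  have "((\<lambda>t::real. \<Sum>n<N. \<Sum>m<N. a n * cnj (a m) * cis (of_int (int n - int m) * t)) has_integral
    (\<Sum>n<N. \<Sum>m<N. a n * cnj (a m) * (if int n - int m = 0 then 2 * pi else 0))) {0..2 * pi}"
    by (intro has_integral_sum has_integral_mult_right has_integral_cis_period) auto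
  also have "(\<lambda>t::real. \<Sum>n<N. \<Sum>m<N. a n * cnj (a m) * cis (of_int (int n - int m) * t)) =
    (\<lambda>t::real. (\<Sum>n<N. a n * cis (n * t)) * cnj (\<Sum>n<N. a n * cis (n * t)))"
    unfolding cis by (simp add: sum_product mult_ac)
  also have "(\<Sum>n<N. \<Sum>m<N. a n * cnj (a m) * (if int n - int m = 0 then 2 * pi else 0)) =
    (\<Sum>n<N. \<Sum>m<N. if n = m then 2 * pi * (a n * cnj (a m)) else 0)"
    by (intro sum.cong) auto
  also have "\<dots> = 2 * pi * (\<Sum>n<N. (cmod (a n))\<^sup>2)"
    by (simp add: sum_distrib_left complex_norm_square del: of_real_power)
  finally show ?thesis .
qed

text \<open>The Weierstrass M-test makes the partial sums converge uniformly, so the identity for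
  trigonometric polynomials passes to the limit.\<close>

lemma Parseval_absolutely_convergent:
  fixes a :: "nat \<Rightarrow> complex"
  assumes "summable (\<lambda>n. cmod (a n))"
  shows "\<exists>J. (\<lambda>n. (cmod (a n))\<^sup>2) sums J \<and>
    ((\<lambda>t. (cmod (\<Sum>n. a n * cis (n * t)))\<^sup>2) has_integral (2 * pi * J)) {0..2 * pi}"
proof -
  let ?S = "\<lambda>N t::real. \<Sum>n<N. a n * cis (n * t)" and ?F = "\<lambda>t::real. \<Sum>n. a n * cis (n * t)"
  have lim: "uniform_limit {0..2 * pi} ?S ?F sequentially"
    using assms by (intro Weierstrass_m_test[where M = "\<lambda>n. cmod (a n)"]) (simp_all add: norm_mult)
  \<comment> \<open>Boundedness of the limit is what \<open>uniform_lim_mult\<close> asks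
    for.\<close>
  have "cmod (?F t) \<le> (\<Sum>n. cmod (a n))" for t
    using summable_norm[of "\<lambda>n. a n * cis (n * t)"] assms by (simp add: norm_mult)
  then have bdd: "bounded (?F ` {0..2 * pi})"
    by (auto simp: bounded_iff)
  then have bdd': "bounded ((\<lambda>t. cnj (?F t)) ` {0..2 * pi})"
    by (simp add: bounded_iff)
  have "uniform_limit {0..2 * pi} (\<lambda>N t. ?S N t * cnj (?S N t)) (\<lambda>t. ?F t * cnj (?F t)) sequentially"
    by (intro uniform_lim_mult bounded_linear.uniform_limit[OF bounded_linear_cnj] lim bdd bdd')
  moreover have "continuous_on {0..2 * pi} (\<lambda>t. ?S N t * cnj (?S N t))" for N
    unfolding cis_conv_exp by (intro continuous_intros)
  ultimately obtain I J where I: "\<And>N. ((\<lambda>t. ?S N t * cnj (?S N t)) has_integral I N) {0..2 * pi}"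
    and J: "((\<lambda>t::real. ?F t * cnj (?F t)) has_integral J) {0..2 * pi}" and IJ: "I \<longlonglongrightarrow> J"
    by (rule uniform_limit_integral[OF _ _ sequentially_bot]) blast
  have "I N = 2 * pi * (\<Sum>n<N. (cmod (a n))\<^sup>2)" for N
    using has_integral_unique[OF I has_integral_trigonometric_polynomial] .
  \<comment> \<open>The complex limit \<open>J\<close> is not yet known to be real; the integrals
    \<open>I N\<close> are, so real parts suffice.\<close>
  then have "(\<lambda>N. 2 * pi * (\<Sum>n<N. (cmod (a n))\<^sup>2)) \<longlonglongrightarrow> Re J"
    using tendsto_Re[OF IJ] by simp
  then have "(\<lambda>N. (2 * pi * (\<Sum>n<N. (cmod (a n))\<^sup>2)) / (2 * pi)) \<longlonglongrightarrow> Re J / (2 * pi)"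
    by (intro tendsto_divide tendsto_const) simp_all
  then have "(\<lambda>n. (cmod (a n))\<^sup>2) sums (Re J / (2 * pi))"
    by (simp add: sums_def)
  moreover have "((\<lambda>t::real. (cmod (?F t))\<^sup>2) has_integral Re J) {0..2 * pi}"
    using has_integral_linear[OF J bounded_linear_Re]
    by (simp add: o_def complex_mult_cnj cmod_def del: complex_cnj_mult)
  ultimately show ?thesis
    by (intro exI[of _ "Re J / (2 * pi)"]) simp
qed

lemma Parseval_circle:
  assumes "f holomorphic_on unit_disc" "0 \<le> r" "r < 1"
  obtains J where "(\<lambda>n. (cmod (taylor_coeff f n) * r ^ n)\<^sup>2) sums J"
    and "((\<lambda>t::real. (cmod (f (r * cis t)))\<^sup>2) has_integral (2 * pi * J)) {0..2 * pi}"
proof -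
  \<comment> \<open>Convergence at the larger radius \<open>s\<close> gives absolute convergence at
    \<open>r\<close>.\<close>
  obtain s where s: "r < s" "s < 1"
    using dense[OF assms(3)] by blast
  have "summable (\<lambda>n. taylor_coeff f n * complex_of_real s ^ n)"
    using taylor_coeff_sums[OF assms(1), of "complex_of_real s"] s assms(2) by (simp add: sums_iff)
  then have "summable (\<lambda>n. norm (taylor_coeff f n * complex_of_real r ^ n))"
    by (rule powser_insidea) (use s assms(2) in simp)
  from Parseval_absolutely_convergent[OF this] obtain J
    where J: "(\<lambda>n. (cmod (taylor_coeff f n) * r ^ n)\<^sup>2) sums J"
      "((\<lambda>t::real. (cmod (\<Sum>n. taylor_coeff f n * complex_of_real r ^ n * cis (n * t)))\<^sup>2)
        has_integral (2 * pi * J)) {0..2 * pi}"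
    using assms(2) by (auto simp: norm_mult norm_power)
  have "(\<Sum>n. taylor_coeff f n * complex_of_real r ^ n * cis (n * t)) = f (r * cis t)" for t :: real
    using sums_unique[OF taylor_coeff_sums[OF assms(1), of "r * cis t"]] assms(2,3)
    by (simp add: norm_mult power_mult_distrib mult.assoc flip: Complex.DeMoivre)
  with J that show thesis
    by simp
qed

text \<open>On each circle of radius r < 1 the pointwise bound on the symbol can be integrated, and
  Parseval turns it into a bound on weighted coefficients that is uniform in r. Letting r tend to 1
  gives membership and the norm bound.\<close>

lemma
  assumes \<psi>: "\<psi> holomorphic_on unit_disc" "\<And>z. z \<in> unit_disc \<Longrightarrow> cmod (\<psi> z) \<le> M"
    and f: "f \<in> hardy2"
  shows mult_op_hardy2: "mult_op \<psi> f \<in> hardy2"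
    and hardy2_norm_mult_op_le: "hardy2_norm (mult_op \<psi> f) \<le> M * hardy2_norm f"
proof -
  let ?g = "mult_op \<psi> f"
  have M: "0 \<le> M"
    using order_trans[OF norm_ge_zero \<psi>(2)[of 0]] by simp
  have g: "?g holomorphic_on unit_disc"
    unfolding mult_op_def by (intro holomorphic_intros \<psi>(1) hardy2D(1) f)
  have bound_r: "(\<Sum>n<N. (cmod (taylor_coeff ?g n) * r ^ n)\<^sup>2) \<le> (M * hardy2_norm f)\<^sup>2"
    if r: "0 \<le> r" "r < 1" for N and r :: real
  proof -
    obtain I where I: "(\<lambda>n. (cmod (taylor_coeff f n) * r ^ n)\<^sup>2) sums I"
      "((\<lambda>t::real. (cmod (f (r * cis t)))\<^sup>2) has_integral (2 * pi * I)) {0..2 * pi}"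
      by (rule Parseval_circle[OF hardy2D(1)[OF f] r])
    obtain J where J: "(\<lambda>n. (cmod (taylor_coeff ?g n) * r ^ n)\<^sup>2) sums J"
      "((\<lambda>t::real. (cmod (?g (r * cis t)))\<^sup>2) has_integral (2 * pi * J)) {0..2 * pi}"
      by (rule Parseval_circle[OF g r])
    have "(\<Sum>n<N. (cmod (taylor_coeff ?g n) * r ^ n)\<^sup>2) \<le> J"
      using J(1) by (auto simp: sums_iff intro!: sum_le_suminf)
    also have "2 * pi * J \<le> M\<^sup>2 * (2 * pi * I)"
      by (rule has_integral_le[OF J(2) has_integral_mult_right[OF I(2)]])
        (use r M \<psi>(2) in \<open>auto simp: mult_op_def norm_mult power_mult_distrib
          intro!: mult_right_mono power_mono\<close>)
    then have "J \<le> M\<^sup>2 * I"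
      by simp
    also have "I \<le> (hardy2_norm f)\<^sup>2"
      unfolding hardy2_norm_power2[OF f]
    proof (rule sums_le[OF _ I(1) summable_sums[OF hardy2D(2)[OF f]]])
      fix n
      have "r ^ n \<le> 1"
        using r by (simp add: power_le_one)
      then show "(cmod (taylor_coeff f n) * r ^ n)\<^sup>2 \<le> (cmod (taylor_coeff f n))\<^sup>2"
        using r by (intro power_mono mult_left_le) auto
    qed
    then have "M\<^sup>2 * I \<le> (M * hardy2_norm f)\<^sup>2"
      by (simp add: power_mult_distrib mult_left_mono)
    finally show ?thesis .
  qed
  \<comment> \<open>The limit r -> 1 is taken in finite sums only, so no limits have to be
    interchanged.\<close>
  have bound: "(\<Sum>n<N. (cmod (taylor_coeff ?g n))\<^sup>2) \<le> (M * hardy2_norm f)\<^sup>2" for N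
  proof (rule tendsto_upperbound)
    show "((\<lambda>r. \<Sum>n<N. (cmod (taylor_coeff ?g n) * r ^ n)\<^sup>2) \<longlongrightarrow>
      (\<Sum>n<N. (cmod (taylor_coeff ?g n))\<^sup>2)) (at_left 1)"
      by (auto intro!: tendsto_eq_intros)
    show "\<forall>\<^sub>F r in at_left 1. (\<Sum>n<N. (cmod (taylor_coeff ?g n) * r ^ n)\<^sup>2) \<le> (M * hardy2_norm f)\<^sup>2"
      using eventually_at_left_real[of 0 1] by (auto elim!: eventually_mono intro: bound_r)
  qed simp
  have summable: "summable (\<lambda>n. (cmod (taylor_coeff ?g n))\<^sup>2)"
    by (rule summableI_nonneg_bounded[OF _ bound]) simp
  with g f show "?g \<in> hardy2"
    by (auto simp: hardy2_def mult_op_def)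
  show "hardy2_norm ?g \<le> M * hardy2_norm f"
    unfolding hardy2_norm_def[of ?g] using suminf_le_const[OF summable bound] M hardy2_norm_nonneg[OF f]
    by (intro real_le_lsqrt) (auto intro: suminf_nonneg summable)
qed

subsection \<open>Riesz representation and adjoints\<close>

text \<open>Takes an arbitrary sequence: the Riesz argument truncates a sequence before its
  square-summability is known.\<close>

definition hardy2_truncate :: "(nat \<Rightarrow> complex) \<Rightarrow> nat \<Rightarrow> complex \<Rightarrow> complex"
  where "hardy2_truncate a N = hardy2_of_coeffs (\<lambda>n. if n < N then a n else 0)"

definition hardy2_monom :: "nat \<Rightarrow> complex \<Rightarrow> complex"
  where "hardy2_monom k = hardy2_of_coeffs (\<lambda>n. if n = k then 1 else 0)"

lemma sums_power2_norm_truncate: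
  fixes a :: "nat \<Rightarrow> complex"
  shows "(\<lambda>n. (cmod (if n < N then a n else 0))\<^sup>2) sums (\<Sum>n<N. (cmod (a n))\<^sup>2)"
proof -
  have "(\<lambda>n. (cmod (if n < N then a n else 0))\<^sup>2) = (\<lambda>n. if n \<in> {..<N} then (cmod (a n))\<^sup>2 else 0)"
    by auto
  then show ?thesis
    using sums_If_finite_set[of "{..<N}" "\<lambda>n. (cmod (a n))\<^sup>2"] by simp
qed

lemma
  shows hardy2_truncate: "hardy2_truncate a N \<in> hardy2"
    and taylor_coeff_hardy2_truncate: "taylor_coeff (hardy2_truncate a N) n = (if n < N then a n else 0)"
    and hardy2_norm_truncate: "hardy2_norm (hardy2_truncate a N) = sqrt (\<Sum>n<N. (cmod (a n))\<^sup>2)"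
proof -
  note sums = sums_power2_norm_truncate[of N a]
  show "hardy2_truncate a N \<in> hardy2"
    unfolding hardy2_truncate_def by (rule hardy2_of_coeffs[OF sums_summable[OF sums]])
  show c: "taylor_coeff (hardy2_truncate a N) n = (if n < N then a n else 0)" for n
    unfolding hardy2_truncate_def by (rule taylor_coeff_hardy2_of_coeffs[OF sums_summable[OF sums]])
  show "hardy2_norm (hardy2_truncate a N) = sqrt (\<Sum>n<N. (cmod (a n))\<^sup>2)"
    unfolding hardy2_norm_def c using sums by (simp add: sums_iff)
qed

lemma
  shows hardy2_monom: "hardy2_monom k \<in> hardy2"
    and taylor_coeff_hardy2_monom: "taylor_coeff (hardy2_monom k) n = (if n = k then 1 else 0)"
proof -
  have "(\<lambda>n. (cmod (if n = k then 1 else 0))\<^sup>2) = (\<lambda>n. if n = k then 1 else 0)"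
    by auto
  then have "summable (\<lambda>n. (cmod (if n = k then 1 else 0))\<^sup>2)"
    using sums_summable[OF sums_single[of k "\<lambda>_. 1 :: real"]] by simp
  from hardy2_of_coeffs[OF this] taylor_coeff_hardy2_of_coeffs[OF this]
  show "hardy2_monom k \<in> hardy2" "taylor_coeff (hardy2_monom k) n = (if n = k then 1 else 0)"
    by (simp_all add: hardy2_monom_def)
qed

text \<open>Density of polynomials: the squared distance is the tail of a convergent series.\<close>

lemma hardy2_norm_diff_truncate_tendsto_0:
  assumes "f \<in> hardy2"
  shows "(\<lambda>N. hardy2_norm (\<lambda>z. f z - hardy2_truncate (taylor_coeff f) N z)) \<longlonglongrightarrow> 0"
proof -
  let ?c = "\<lambda>n. (cmod (taylor_coeff f n))\<^sup>2"
  have "hardy2_norm (\<lambda>z. f z - hardy2_truncate (taylor_coeff f) N z) = sqrt ((\<Sum>n. ?c n) - (\<Sum>n<N. ?c n))"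
    for N
  proof -
    have "(\<lambda>n. ?c n - (cmod (if n < N then taylor_coeff f n else 0))\<^sup>2) sums ((\<Sum>n. ?c n) - (\<Sum>n<N. ?c n))"
      by (intro sums_diff sums_power2_norm_truncate summable_sums hardy2D assms)
    also have "(\<lambda>n. ?c n - (cmod (if n < N then taylor_coeff f n else 0))\<^sup>2) =
      (\<lambda>n. (cmod (taylor_coeff (\<lambda>z. f z - hardy2_truncate (taylor_coeff f) N z) n))\<^sup>2)"
      by (simp add: fun_eq_iff taylor_coeff_diff hardy2D assms hardy2_truncate taylor_coeff_hardy2_truncate)
    finally show ?thesis
      by (simp add: hardy2_norm_def sums_iff)
  qed
  moreover have "(\<lambda>N. sqrt ((\<Sum>n. ?c n) - (\<Sum>n<N. ?c n))) \<longlonglongrightarrow> sqrt ((\<Sum>n. ?c n) - (\<Sum>n. ?c n))"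
    by (intro tendsto_intros summable_LIMSEQ hardy2D assms)
  ultimately show ?thesis
    by simp
qed

text \<open>The values of \<open>L\<close> on monomials dictate the coefficients of the representing
  vector. Testing \<open>L\<close> on truncations of that vector shows square-summability, and
  agreement on polynomials extends by density and the bound on \<open>L\<close>.\<close>

lemma hardy2_Riesz_representation:
  assumes add: "\<And>f g. f \<in> hardy2 \<Longrightarrow> g \<in> hardy2 \<Longrightarrow> L (\<lambda>z. f z + g z) = L f + L g"
    and cmult: "\<And>a f. f \<in> hardy2 \<Longrightarrow> L (\<lambda>z. a * f z) = a * L f"
    and bound: "\<And>f. f \<in> hardy2 \<Longrightarrow> cmod (L f) \<le> M * hardy2_norm f"
  shows "\<exists>h\<in>hardy2. \<forall>f\<in>hardy2. L f = hardy2_inner f h"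
proof -
  define b where "b n = cnj (L (hardy2_monom n))" for n
  have L_truncate: "L (hardy2_truncate a N) = (\<Sum>n<N. a n * cnj (b n))" for a N
  proof (induction N)
    case 0
    \<comment> \<open>The zero function is written as a scalar multiple so that homogeneity gives
      \<open>L\<close> the value 0 on it.\<close>
    have "hardy2_truncate a 0 = (\<lambda>z. 0 * hardy2_monom 0 z)"
      by (rule hardy2_eqI)
        (simp_all only: hardy2_cmult hardy2_monom hardy2_truncate taylor_coeff_cmult hardy2D
          taylor_coeff_hardy2_truncate, simp)
    then show ?case
      using cmult[of "hardy2_monom 0" 0] by (simp add: hardy2_monom)
  next
    case (Suc N)
    have "hardy2_truncate a (Suc N) = (\<lambda>z. hardy2_truncate a N z + a N * hardy2_monom N z)"
      by (rule hardy2_eqI)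
        (simp_all add: hardy2_add hardy2_cmult hardy2_monom hardy2_truncate taylor_coeff_add
          taylor_coeff_cmult hardy2D holomorphic_on_mult taylor_coeff_hardy2_truncate taylor_coeff_hardy2_monom less_Suc_eq)
    then show ?case
      using Suc by (simp add: add cmult hardy2_truncate hardy2_monom hardy2_cmult b_def)
  qed
  have b_bound: "(\<Sum>n<N. (cmod (b n))\<^sup>2) \<le> M\<^sup>2" for N
  proof -
    let ?S = "\<Sum>n<N. (cmod (b n))\<^sup>2"
    have "L (hardy2_truncate b N) = complex_of_real ?S"
      by (simp add: L_truncate complex_norm_square del: of_real_power)
    then have "?S \<le> M * sqrt ?S"
      using bound[OF hardy2_truncate, of b N]
      by (simp add: hardy2_norm_truncate sum_nonneg del: of_real_sum of_real_power)
    moreover have "?S = sqrt ?S * sqrt ?S" "0 \<le> sqrt ?S"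
      by (simp_all add: sum_nonneg)
    \<comment> \<open>Cancelling \<open>sqrt ?S\<close> needs it to be positive; if it is 0, the
      bound by the square of \<open>M\<close> is trivial.\<close>
    ultimately have "sqrt ?S = 0 \<or> 0 \<le> sqrt ?S \<and> sqrt ?S \<le> M"
      by (metis mult_right_le_imp_le order_le_less)
    then show ?thesis
      by (metis real_sqrt_eq_zero_cancel_iff zero_le_power2 sqrt_le_D)
  qed
  have b_summable: "summable (\<lambda>n. (cmod (b n))\<^sup>2)"
    by (rule summableI_nonneg_bounded[OF _ b_bound]) simp
  show ?thesis
  proof (intro bexI ballI)
    show h: "hardy2_of_coeffs b \<in> hardy2"
      by (rule hardy2_of_coeffs[OF b_summable])
    fix f assume f: "f \<in> hardy2"
    let ?f = "hardy2_truncate (taylor_coeff f)"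
    have "(\<lambda>N. L (?f N)) \<longlonglongrightarrow> hardy2_inner f (hardy2_of_coeffs b)"
      using hardy2_inner_sums[OF f h]
      by (simp add: L_truncate sums_def taylor_coeff_hardy2_of_coeffs[OF b_summable])
    moreover have "(\<lambda>N. L (?f N)) \<longlonglongrightarrow> L f"
    proof (rule Lim_transform2[OF tendsto_const])
      show "(\<lambda>N. L f - L (?f N)) \<longlonglongrightarrow> 0"
      proof (rule Lim_null_comparison)
        have "cmod (L f - L (?f N)) \<le> M * hardy2_norm (\<lambda>z. f z - ?f N z)" for N
        proof -
          have d: "(\<lambda>z. f z - ?f N z) \<in> hardy2"
            by (intro hardy2_diff f hardy2_truncate)
          from add[OF d hardy2_truncate, of "taylor_coeff f" N] have "L f = L (\<lambda>z. f z - ?f N z) + L (?f N)"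
            by simp
          with bound[OF d] show ?thesis
            by simp
        qed
        then show "\<forall>\<^sub>F N in sequentially. cmod (L f - L (?f N)) \<le> M * hardy2_norm (\<lambda>z. f z - ?f N z)"
          by simp
        show "(\<lambda>N. M * hardy2_norm (\<lambda>z. f z - ?f N z)) \<longlonglongrightarrow> 0"
          by (intro tendsto_mult_right_zero hardy2_norm_diff_truncate_tendsto_0 f)
      qed
    qed
    ultimately show "L f = hardy2_inner f (hardy2_of_coeffs b)"
      using LIMSEQ_unique by blast
  qed
qed

lemma hardy2_inner_add_left:
  assumes "f \<in> hardy2" "g \<in> hardy2" "h \<in> hardy2"
  shows "hardy2_inner (\<lambda>z. f z + g z) h = hardy2_inner f h + hardy2_inner g h"
proof -
  have "(\<lambda>n. taylor_coeff (\<lambda>z. f z + g z) n * cnj (taylor_coeff h n))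
    sums (hardy2_inner f h + hardy2_inner g h)"
    using sums_add[OF hardy2_inner_sums[OF assms(1,3)] hardy2_inner_sums[OF assms(2,3)]] assms
    by (simp add: taylor_coeff_add hardy2D distrib_right)
  then show ?thesis
    by (simp add: hardy2_inner_def sums_iff)
qed

lemma hardy2_inner_cmult_left:
  assumes "f \<in> hardy2" "h \<in> hardy2"
  shows "hardy2_inner (\<lambda>z. a * f z) h = a * hardy2_inner f h"
  using sums_mult[OF hardy2_inner_sums[OF assms], of a] assms
  by (simp add: hardy2_inner_def taylor_coeff_cmult hardy2D mult.assoc sums_iff)

lemma hardy2_inner_monom_left: "hardy2_inner (hardy2_monom k) h = cnj (taylor_coeff h k)"
proof -
  have "(\<lambda>n. taylor_coeff (hardy2_monom k) n * cnj (taylor_coeff h n)) =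
    (\<lambda>n. if n = k then cnj (taylor_coeff h n) else 0)"
    by (auto simp: taylor_coeff_hardy2_monom)
  then show ?thesis
    using sums_single[of k "\<lambda>n. cnj (taylor_coeff h n)"] by (simp add: hardy2_inner_def sums_iff)
qed

text \<open>Justifies the definite description in \<open>hardy2_adjoint\<close>: existence is Riesz
  representation for the functional sending f to the inner product of \<psi> f with g, and
  uniqueness follows by testing against monomials.\<close>

lemma
  assumes \<psi>: "\<psi> holomorphic_on unit_disc" "bounded (\<psi> ` unit_disc)" and g: "g \<in> hardy2"
  shows hardy2_adjoint_mult_op: "hardy2_adjoint (mult_op \<psi>) g \<in> hardy2"
    and hardy2_inner_adjoint_mult_op:
      "f \<in> hardy2 \<Longrightarrow> hardy2_inner f (hardy2_adjoint (mult_op \<psi>) g) = hardy2_inner (mult_op \<psi> f) g"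
proof -
  let ?P = "\<lambda>h. h \<in> hardy2 \<and> (\<forall>f\<in>hardy2. hardy2_inner (mult_op \<psi> f) g = hardy2_inner f h)"
  obtain M where M: "\<And>z. z \<in> unit_disc \<Longrightarrow> cmod (\<psi> z) \<le> M"
    using \<psi>(2) unfolding bounded_iff by blast
  note closed = mult_op_hardy2[OF \<psi>(1) M]
  have "\<exists>h\<in>hardy2. \<forall>f\<in>hardy2. hardy2_inner (mult_op \<psi> f) g = hardy2_inner f h"
  proof (rule hardy2_Riesz_representation[where M = "M * hardy2_norm g"])
    fix f f' assume f: "f \<in> hardy2" and f': "f' \<in> hardy2"
    show "hardy2_inner (mult_op \<psi> (\<lambda>z. f z + f' z)) g =
      hardy2_inner (mult_op \<psi> f) g + hardy2_inner (mult_op \<psi> f') g"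
      using hardy2_inner_add_left[OF closed[OF _ f] closed[OF _ f'] g]
      by (simp add: mult_op_def distrib_left)
  next
    fix f a assume f: "f \<in> hardy2"
    show "hardy2_inner (mult_op \<psi> (\<lambda>z. a * f z)) g = a * hardy2_inner (mult_op \<psi> f) g"
      using hardy2_inner_cmult_left[OF closed[OF _ f] g, of a]
      by (simp add: mult_op_def mult.left_commute)
  next
    fix f assume f: "f \<in> hardy2"
    have "cmod (hardy2_inner (mult_op \<psi> f) g) \<le> hardy2_norm (mult_op \<psi> f) * hardy2_norm g"
      by (intro norm_hardy2_inner_le closed f g)
    also have "\<dots> \<le> M * hardy2_norm f * hardy2_norm g"
      by (intro mult_right_mono hardy2_norm_mult_op_le \<psi> M f hardy2_norm_nonneg g)
    finally show "cmod (hardy2_inner (mult_op \<psi> f) g) \<le> M * hardy2_norm g * hardy2_norm f"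
      by (simp add: mult_ac)
  qed
  then obtain h where h: "?P h"
    by blast
  moreover have "h' = h" if "?P h'" for h'
  proof (rule hardy2_eqI)
    fix n
    have "hardy2_inner (hardy2_monom n) h' = hardy2_inner (hardy2_monom n) h"
      using h that hardy2_monom by metis
    then show "taylor_coeff h' n = taylor_coeff h n"
      by (simp add: hardy2_inner_monom_left)
  qed (use h that in auto)
  ultimately have "?P (hardy2_adjoint (mult_op \<psi>) g)"
    unfolding hardy2_adjoint_def by (rule theI[where P = ?P])
  then show "hardy2_adjoint (mult_op \<psi>) g \<in> hardy2"
    "f \<in> hardy2 \<Longrightarrow> hardy2_inner f (hardy2_adjoint (mult_op \<psi>) g) = hardy2_inner (mult_op \<psi> f) g"
    by auto
qed

subsection \<open>Orbits\<close>

lemma hardy2_norm_adjoint_mult_op_le: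
  assumes \<psi>: "\<psi> holomorphic_on unit_disc" "\<And>z. z \<in> unit_disc \<Longrightarrow> cmod (\<psi> z) \<le> M"
    and g: "g \<in> hardy2"
  shows "hardy2_norm (hardy2_adjoint (mult_op \<psi>) g) \<le> M * hardy2_norm g"
proof -
  let ?h = "hardy2_adjoint (mult_op \<psi>) g"
  have M: "0 \<le> M"
    using order_trans[OF norm_ge_zero \<psi>(2)[of 0]] by simp
  have bdd: "bounded (\<psi> ` unit_disc)"
    unfolding bounded_iff using \<psi>(2) by blast
  have h: "?h \<in> hardy2"
    by (rule hardy2_adjoint_mult_op[OF \<psi>(1) bdd g])
  have "(hardy2_norm ?h)\<^sup>2 = cmod (hardy2_inner (mult_op \<psi> ?h) g)"
    using hardy2_inner_adjoint_mult_op[OF \<psi>(1) bdd g h] norm_hardy2_inner_self[OF h] by simp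
  also have "\<dots> \<le> hardy2_norm (mult_op \<psi> ?h) * hardy2_norm g"
    by (intro norm_hardy2_inner_le mult_op_hardy2[OF \<psi>] h g)
  also have "\<dots> \<le> M * hardy2_norm ?h * hardy2_norm g"
    by (intro mult_right_mono hardy2_norm_mult_op_le \<psi> h hardy2_norm_nonneg g)
  finally have "hardy2_norm ?h * hardy2_norm ?h \<le> M * hardy2_norm g * hardy2_norm ?h"
    by (simp add: power2_eq_square mult_ac)
  \<comment> \<open>Cancel the norm of \<open>?h\<close>; if it vanishes, the right-hand side is
    still nonnegative.\<close>
  then show ?thesis
    using hardy2_norm_nonneg[OF h] mult_nonneg_nonneg[OF M hardy2_norm_nonneg[OF g]]
    by (metis mult_right_le_imp_le order_le_less)
qed

lemma hardy2_norm_adjoint_mult_op_ge: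
  assumes \<psi>: "\<psi> holomorphic_on unit_disc" "bounded (\<psi> ` unit_disc)"
      "\<And>z. z \<in> unit_disc \<Longrightarrow> 1 \<le> cmod (\<psi> z)"
    and g: "g \<in> hardy2"
  shows "hardy2_norm g \<le> hardy2_norm (hardy2_adjoint (mult_op \<psi>) g)"
proof -
  let ?h = "hardy2_adjoint (mult_op \<psi>) g" and ?\<chi> = "\<lambda>z. inverse (\<psi> z)"
  have nz: "\<psi> z \<noteq> 0" if "z \<in> unit_disc" for z
    using \<psi>(3)[OF that] by auto
  have \<chi>: "?\<chi> holomorphic_on unit_disc" "\<And>z. z \<in> unit_disc \<Longrightarrow> cmod (?\<chi> z) \<le> 1"
    using \<psi>(1,3) nz by (auto intro!: holomorphic_intros simp: norm_inverse inverse_le_1_iff)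
  have h: "?h \<in> hardy2"
    by (rule hardy2_adjoint_mult_op[OF \<psi>(1,2) g])
  have k: "mult_op ?\<chi> g \<in> hardy2" "hardy2_norm (mult_op ?\<chi> g) \<le> hardy2_norm g"
    using mult_op_hardy2[OF \<chi> g] hardy2_norm_mult_op_le[OF \<chi> g] by simp_all
  \<comment> \<open>The equality holds for total functions: off the disc both sides vanish because
    \<open>g\<close> does.\<close>
  have "mult_op \<psi> (mult_op ?\<chi> g) = g"
  proof
    fix z
    show "mult_op \<psi> (mult_op ?\<chi> g) z = g z"
      using nz[of z] hardy2D(3)[OF g, of z] by (cases "z \<in> unit_disc") (simp_all add: mult_op_def)
  qed
  then have "(hardy2_norm g)\<^sup>2 = cmod (hardy2_inner (mult_op ?\<chi> g) ?h)"
    using hardy2_inner_adjoint_mult_op[OF \<psi>(1,2) g k(1)] norm_hardy2_inner_self[OF g]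
    by simp
  also have "\<dots> \<le> hardy2_norm (mult_op ?\<chi> g) * hardy2_norm ?h"
    by (intro norm_hardy2_inner_le k h)
  also have "\<dots> \<le> hardy2_norm g * hardy2_norm ?h"
    by (intro mult_right_mono k hardy2_norm_nonneg h)
  finally have "hardy2_norm g * hardy2_norm g \<le> hardy2_norm ?h * hardy2_norm g"
    by (simp add: power2_eq_square mult_ac)
  then show ?thesis
    using hardy2_norm_nonneg[OF h] hardy2_norm_nonneg[OF g]
    by (metis mult_right_le_imp_le order_le_less)
qed

text \<open>Rotation multiplies the n-th coefficient by \<open>c ^ n\<close>, which is
  unimodular.\<close>

lemma
  assumes "cmod c = 1" "f \<in> hardy2"
  shows rotation_op_hardy2: "rotation_op c f \<in> hardy2"
    and hardy2_norm_rotation_op: "hardy2_norm (rotation_op c f) = hardy2_norm f"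
proof -
  have "(\<lambda>z. f (c * z)) holomorphic_on unit_disc"
    by (rule holomorphic_on_compose_gen[of "\<lambda>z. c * z" unit_disc f unit_disc, unfolded o_def])
      (use assms in \<open>auto simp: norm_mult hardy2D intro!: holomorphic_intros\<close>)
  moreover have c: "taylor_coeff (\<lambda>z. f (c * z)) n = taylor_coeff f n * c ^ n" for n
    by (rule taylor_coeff_eqI)
      (use taylor_coeff_sums[OF hardy2D(1)[OF assms(2)], of "c * _"] assms(1) in
        \<open>simp add: norm_mult power_mult_distrib mult.assoc\<close>)
  ultimately show "rotation_op c f \<in> hardy2" "hardy2_norm (rotation_op c f) = hardy2_norm f"
    using assms by (auto simp: rotation_op_def hardy2_def hardy2_norm_def norm_mult norm_power)
qed

section \<open>Obstructions to dense orbits\<close>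

lemma bounded_not_dense_hardy2:
  assumes "\<And>h. h \<in> S \<Longrightarrow> h \<in> hardy2" "\<And>h. h \<in> S \<Longrightarrow> hardy2_norm h \<le> C"
  shows "\<exists>g\<in>hardy2. \<forall>h\<in>S. 1 \<le> hardy2_norm (\<lambda>z. h z - g z)"
proof (intro bexI ballI)
  \<comment> \<open>On the disc this is the constant C + 1. Zeroth coefficients of members of
    \<open>S\<close> have modulus at most \<open>C\<close>, so this coefficient alone keeps them at
    distance at least 1.\<close>
  let ?g = "\<lambda>z. complex_of_real (C + 1) * hardy2_monom 0 z"
  show g: "?g \<in> hardy2"
    by (intro hardy2_cmult hardy2_monom)
  fix h assume "h \<in> S"
  with assms have h: "h \<in> hardy2" "hardy2_norm h \<le> C"
    by blast+
  have "1 \<le> cmod (complex_of_real (C + 1)) - cmod (taylor_coeff h 0)"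
    using norm_taylor_coeff_le[OF h(1), of 0] h(2) by (simp del: of_real_add)
  also have "\<dots> \<le> cmod (taylor_coeff h 0 - complex_of_real (C + 1))"
    by (metis norm_minus_commute norm_triangle_ineq2)
  also have "taylor_coeff h 0 - complex_of_real (C + 1) = taylor_coeff (\<lambda>z. h z - ?g z) 0"
    using h(1) g by (simp add: taylor_coeff_diff taylor_coeff_cmult hardy2D hardy2_monom
        taylor_coeff_hardy2_monom del: of_real_add)
  also have "cmod (taylor_coeff (\<lambda>z. h z - ?g z) 0) \<le> hardy2_norm (\<lambda>z. h z - ?g z)"
    by (rule norm_taylor_coeff_le[OF hardy2_diff[OF h(1) g]])
  finally show "1 \<le> hardy2_norm (\<lambda>z. h z - ?g z)" .
qed

lemma not_hypercyclic_contraction: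
  assumes "\<And>f. f \<in> hardy2 \<Longrightarrow> T f \<in> hardy2" "\<And>f. f \<in> hardy2 \<Longrightarrow> hardy2_norm (T f) \<le> hardy2_norm f"
  shows "\<not> hypercyclic T"
proof
  assume "hypercyclic T"
  then obtain f where f: "f \<in> hardy2"
    and dense: "\<And>g \<epsilon>. g \<in> hardy2 \<Longrightarrow> 0 < \<epsilon> \<Longrightarrow> \<exists>h\<in>orbit T f. hardy2_norm (\<lambda>z. h z - g z) < \<epsilon>"
    unfolding hypercyclic_def by blast
  have "(T ^^ n) f \<in> hardy2 \<and> hardy2_norm ((T ^^ n) f) \<le> hardy2_norm f" for n
    by (induction n) (auto simp: f intro: assms order_trans[OF assms(2)])
  then have "\<exists>g\<in>hardy2. \<forall>h\<in>orbit T f. 1 \<le> hardy2_norm (\<lambda>z. h z - g z)"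
    by (intro bounded_not_dense_hardy2) (auto simp: orbit_def)
  then show False
    using dense[of _ 1] by (auto simp: not_less[symmetric])
qed

text \<open>A nonzero starting vector keeps its orbit away from 0. The bound with \<open>M\<close>
  handles norm 0: in place of linearity, it keeps the whole orbit at norm 0.\<close>

lemma not_hypercyclic_expansion:
  assumes T: "\<And>f. f \<in> hardy2 \<Longrightarrow> T f \<in> hardy2" "\<And>f. f \<in> hardy2 \<Longrightarrow> hardy2_norm f \<le> hardy2_norm (T f)"
    and bound: "\<And>f. f \<in> hardy2 \<Longrightarrow> hardy2_norm (T f) \<le> M * hardy2_norm f"
  shows "\<not> hypercyclic T"
proof
  assume "hypercyclic T"
  then obtain f where f: "f \<in> hardy2"
    and dense: "\<And>g \<epsilon>. g \<in> hardy2 \<Longrightarrow> 0 < \<epsilon> \<Longrightarrow> \<exists>h\<in>orbit T f. hardy2_norm (\<lambda>z. h z - g z) < \<epsilon>"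
    unfolding hypercyclic_def by blast
  have iter: "(T ^^ n) f \<in> hardy2 \<and> hardy2_norm f \<le> hardy2_norm ((T ^^ n) f)" for n
    by (induction n) (auto simp: f intro: T order_trans[OF _ T(2)])
  show False
  proof (cases "hardy2_norm f = 0")
    case True
    have "hardy2_norm ((T ^^ n) f) = 0" for n
    proof (induction n)
      case (Suc n)
      have "hardy2_norm (T ((T ^^ n) f)) \<le> 0"
        using bound[of "(T ^^ n) f"] iter[of n] Suc by simp
      then show ?case
        using hardy2_norm_nonneg[of "T ((T ^^ n) f)"] iter[of n] T(1) by simp
    qed (simp add: True)
    then have "\<exists>g\<in>hardy2. \<forall>h\<in>orbit T f. 1 \<le> hardy2_norm (\<lambda>z. h z - g z)"
      using iter by (intro bounded_not_dense_hardy2[where C = 0]) (auto simp: orbit_def)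
    then show False
      using dense[of _ 1] by (auto simp: not_less[symmetric])
  next
    case False
    then have "0 < hardy2_norm f"
      using hardy2_norm_nonneg[OF f] by simp
    \<comment> \<open>Density is applied to the zero vector, written as 0 times \<open>f\<close>,
      with the norm of \<open>f\<close> as tolerance.\<close>
    from dense[OF hardy2_cmult[OF f, of 0] this] obtain n where "hardy2_norm ((T ^^ n) f) < hardy2_norm f"
      by (auto simp: orbit_def)
    then show False
      using iter[of n] by simp
  qed
qed

theorem proposition4p3:
  fixes c :: complex and \<phi> :: "complex \<Rightarrow> complex"
    and T :: "(complex \<Rightarrow> complex) \<Rightarrow> (complex \<Rightarrow> complex)"
  assumes "cmod c = 1"
    and "\<phi> \<in> hardy_infinity"
    and "T = rotation_op c \<circ> backward_shift_calc \<phi>"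
    and "\<phi> ` unit_disc \<inter> sphere 0 1 = {}"
  shows "\<not> hypercyclic T"
proof -
  define \<psi> where "\<psi> = conj_symbol \<phi>"
  have \<phi>: "\<phi> holomorphic_on unit_disc" "bounded (\<phi> ` unit_disc)"
    using assms(2) by (simp_all add: hardy_infinity_def)
  have cnj_disc: "cnj ` unit_disc = unit_disc"
    by (auto simp: image_iff intro!: bexI[of _ "cnj _"])
  have "cnj \<circ> \<phi> \<circ> cnj holomorphic_on unit_disc"
    using \<phi>(1) holomorphic_on_compose_cnj_cnj[of \<phi> unit_disc] by (simp add: cnj_disc)
  then have hol: "\<psi> holomorphic_on unit_disc"
    by (simp add: \<psi>_def conj_symbol_def o_def)
  obtain M where "\<And>z. z \<in> unit_disc \<Longrightarrow> cmod (\<phi> z) \<le> M"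
    using \<phi>(2) unfolding bounded_iff by blast
  then have M: "cmod (\<psi> z) \<le> M" if "z \<in> unit_disc" for z
    using that by (simp add: \<psi>_def conj_symbol_def)
  then have bdd: "bounded (\<psi> ` unit_disc)"
    unfolding bounded_iff by blast
  have T: "T f = rotation_op c (hardy2_adjoint (mult_op \<psi>) f)" for f
    by (simp add: assms(3) backward_shift_calc_def \<psi>_def)
  note adj = hardy2_adjoint_mult_op[OF hol bdd]
  have T_hardy2: "T f \<in> hardy2" if "f \<in> hardy2" for f
    unfolding T by (intro rotation_op_hardy2 assms(1) adj that)
  have T_norm: "hardy2_norm (T f) = hardy2_norm (hardy2_adjoint (mult_op \<psi>) f)" if "f \<in> hardy2" for f
    unfolding T by (intro hardy2_norm_rotation_op assms(1) adj that)
  \<comment> \<open>Taking moduli moves the argument to the real line: the image is an interval that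
    misses 1, hence lies on one side of it.\<close>
  have "connected ((\<lambda>z. cmod (\<phi> z)) ` unit_disc)"
    by (intro connected_continuous_image continuous_intros holomorphic_on_imp_continuous_on \<phi>(1)) simp
  moreover have "1 \<notin> (\<lambda>z. cmod (\<phi> z)) ` unit_disc"
    using assms(4) by (fastforce simp: image_iff)
  ultimately have "(\<forall>z\<in>unit_disc. cmod (\<phi> z) \<le> 1) \<or> (\<forall>z\<in>unit_disc. 1 \<le> cmod (\<phi> z))"
    unfolding connected_iff_interval by (meson imageI linear)
  \<comment> \<open>Conjugation preserves both the disc and moduli, so the alternative passes from
    \<phi> to \<psi>.\<close>
  then consider "\<And>z. z \<in> unit_disc \<Longrightarrow> cmod (\<psi> z) \<le> 1" | "\<And>z. z \<in> unit_disc \<Longrightarrow> 1 \<le> cmod (\<psi> z)"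
    by (auto simp: \<psi>_def conj_symbol_def)
  then show ?thesis
  proof cases
    case 1
    from hardy2_norm_adjoint_mult_op_le[OF hol this] show ?thesis
      by (intro not_hypercyclic_contraction) (simp_all add: T_hardy2 T_norm)
  next
    case 2
    from hardy2_norm_adjoint_mult_op_ge[OF hol bdd this] hardy2_norm_adjoint_mult_op_le[OF hol M]
    show ?thesis
      by (intro not_hypercyclic_expansion[where M = M]) (simp_all add: T_hardy2 T_norm)
  qed
qed

end
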